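(* Let $f(z)=\sum_{n\ge0} a_n z^{-n}\in\mathbb{C}[[z^{-1}]]$ be a Gevrey-1 formal series with Borel transform $\widetilde f(\zeta)=\sum_{n\ge1} \frac{a_n\zeta^{n-1}}{(n-1)!}$. Let $\lambda>0$ and assume that $\widetilde f$ extends holomorphically to $\Delta_\lambda$ and that there exist $A>0$, $B>0$ with $|\widetilde f(\zeta)|\le A e^{B|\zeta|}$ for all $\zeta\in\Delta_\lambda$. Put $a_n^{(\lambda)}=\lambda^{n-1}a_n$ and, for $n\ge0$, $$b_n^{(\lambda)}=\frac{1}{n!}\sum_{k=1}^{n+1}(-1)^{n-k+1}\mathfrak{s}(n,k-1)\,a_k^{(\lambda)}.$$ Then: (i) the factorial series $a_0+\lambda\sum_{n=0}^{+\infty}\frac{\Gamma(\lambda z)\Gamma(n+1)b_n^{(\lambda)}}{\Gamma(\lambda z+n+1)}$ converges absolutely for $\Re(z)>\max(B,1/\lambda)$, and its sum equals $\mathrm{S}_0 f(z)$ there; (ii) for every integer $N\ge0$ and every $z$ with $\Re(z)>B$, $$\Big|\mathrm{S}_0f(z)-\Big(a_0+\lambda\sum_{n=0}^{N}\frac{\Gamma(\lambda z)\Gamma(n+1)b_n^{(\lambda)}}{\Gamma(\lambda z+n+1)}\Big)\Big|\le R_{fact}(\lambda,A,B,N,z),$$ where $$R_{fact}(\lambda,A,B,N,z)=\frac{A}{(\lambda B)^{\lambda B}}\,\frac{(N+\lambda B+1)^{N+\lambda B+1}}{(N+1)^N}\left|\frac{\Gamma(\lambda z)\Gamma(N+1)}{\Gamma(\lambda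 z+N+1)(\Re(z)-B)}\right|.$$
   Context: $\Delta$ denotes the image of the open disc $D(1,1)=\{s:|s-1|<1\}$ under $s\mapsto-\ln s$ (principal logarithm), and $\Delta_\lambda=\{\lambda\zeta:\zeta\in\Delta\}$. A series $\sum a_n z^{-n}$ is Gevrey-1 if $|a_n|\le CK^n n!$ for some constants. The Borel sum is $\mathrm{S}_0 f(z)=a_0+\int_0^{+\infty}\widetilde f(\zeta)e^{-z\zeta}\,d\zeta$ ($\Re z>B$). Stirling numbers of the first kind: $\prod_{k=0}^{n-1}(x-k)=\sum_{k=0}^n\mathfrak{s}(n,k)x^k$. *)

theory Defs
  imports "HOL-Complex_Analysis.Complex_Analysis" "HOL-Computational_Algebra.Polynomial"
begin

definition Delta :: "complex set" where
  "Delta = (\<lambda>s. - Ln s) ` ball 1 1"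

definition Delta_lam :: "real \<Rightarrow> complex set" where
  "Delta_lam lam = (\<lambda>\<zeta>. complex_of_real lam * \<zeta>) ` Delta"

definition stirling1 :: "nat \<Rightarrow> nat \<Rightarrow> int" where
  "stirling1 n k = coeff (\<Prod>j<n. [: - of_nat j, 1 :]) k"

definition gevrey1 :: "(nat \<Rightarrow> complex) \<Rightarrow> bool" where
  "gevrey1 a \<longleftrightarrow> (\<exists>C K. \<forall>n. norm (a n) \<le> C * K ^ n * fact n)"

definition borel_transform :: "(nat \<Rightarrow> complex) \<Rightarrow> complex \<Rightarrow> complex" where
  "borel_transform a \<zeta> = (\<Sum>n. a (Suc n) * \<zeta> ^ n / fact n)"

text \<open>Borel sum S_0 f(z) = a_0 + int_0^infty F(zeta) e^{-z zeta} d zeta, with F the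
  holomorphic extension of the Borel transform.\<close>
definition borel_sum :: "complex \<Rightarrow> (complex \<Rightarrow> complex) \<Rightarrow> complex \<Rightarrow> complex" where
  "borel_sum a0 F z = a0 + integral {0..} (\<lambda>t::real. F (of_real t) * exp (- (z * of_real t)))"

definition a_lam :: "real \<Rightarrow> (nat \<Rightarrow> complex) \<Rightarrow> nat \<Rightarrow> complex" where
  "a_lam lam a n = complex_of_real lam ^ (n - 1) * a n"

definition b_lam :: "real \<Rightarrow> (nat \<Rightarrow> complex) \<Rightarrow> nat \<Rightarrow> complex" where
  "b_lam lam a n = (1 / fact n) *
     (\<Sum>k=1..n+1. (-1) ^ (n + 1 - k) * of_int (stirling1 n (k - 1)) * a_lam lam a k)"

definition fact_term :: "real \<Rightarrow> (nat \<Rightarrow> complex) \<Rightarrow> complex \<Rightarrow> nat \<Rightarrow> complex" where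
  "fact_term lam a z n =
     Gamma (of_real lam * z) * Gamma (of_nat n + 1) * b_lam lam a n
       / Gamma (of_real lam * z + of_nat n + 1)"

definition R_fact :: "real \<Rightarrow> real \<Rightarrow> real \<Rightarrow> nat \<Rightarrow> complex \<Rightarrow> real" where
  "R_fact lam A B N z =
     A / ((lam * B) powr (lam * B))
     * ((real N + lam * B + 1) powr (real N + lam * B + 1) / (real N + 1) ^ N)
     * norm (Gamma (of_real lam * z) * Gamma (of_nat N + 1)
             / (Gamma (of_real lam * z + of_nat N + 1) * of_real (Re z - B)))"

end

theory Submission
  imports Defs "HOL-Combinatorics.Stirling" "HOL-Real_Asymp.Real_Asymp"
begin

text \<open>
  Put \<open>f u = F (- lam * Ln (1 - u))\<close>, a holomorphic function on the unit disc. The change of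
  variable \<open>\<zeta> = lam * t\<close> turns the Borel sum into \<open>lam\<close> times the Laplace transform at
  \<open>w = lam * z\<close> of \<open>t \<mapsto> f (1 - exp (- t))\<close>, and the \<open>b_lam\<close> are the Taylor coefficients of \<open>f\<close>
  at \<open>0\<close>. Integrating by parts \<open>N + 1\<close> times gives the partial sum of the factorial series plus the
  Laplace transform of \<open>exp (- (N + 1) * t)\<close> times the \<open>(N + 1)\<close>-st derivative of \<open>f\<close> at
  \<open>1 - exp (- t)\<close>, divided by \<open>w (w + 1) \<dots> (w + N)\<close>. Cauchy's estimate on circles of radius
  \<open>\<rho> * exp (- t)\<close>, with optimal \<open>\<rho>\<close>, bounds that remainder by \<open>R_fact\<close>. This bound need not
  tend to \<open>0\<close> on the whole half-plane of (i); there the Taylor series is integrated term by term,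
  using the sharper coefficient bound \<open>O(n powr (b - 1))\<close> for \<open>b > max (lam * B) 1\<close> that an
  \<open>L\<^sup>1\<close> estimate on circles about \<open>0\<close> provides.
\<close>

subsection \<open>Laplace transforms\<close>

lemma has_integral_vector_derivative_atLeast:
  fixes f f' :: "real \<Rightarrow> 'a::euclidean_space"
  assumes deriv: "\<And>t. t \<ge> a \<Longrightarrow> (f has_vector_derivative f' t) (at t)"
    and integrable: "f' absolutely_integrable_on {a..}"
    and lim: "(f \<longlongrightarrow> l) at_top"
  shows "(f' has_integral l - f a) {a..}"
proof -
  have integral_Icc: "(LINT t:{a..b}|lebesgue. f' t) = f b - f a" if "b \<ge> a" for b
  proof -
    have "(f' has_integral f b - f a) {a..b}"
      by (rule fundamental_theorem_of_calculus)
        (use that deriv in \<open>auto intro: has_vector_derivative_at_within\<close>)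
    moreover have "f' absolutely_integrable_on {a..b}"
      by (rule set_integrable_subset[OF integrable]) auto
    ultimately show ?thesis
      by (simp add: set_lebesgue_integral_eq_integral integral_unique)
  qed
  have "((\<lambda>b. LINT t:{a..b}|lebesgue. f' t) \<longlongrightarrow> (LINT t:{a..}|lebesgue. f' t)) at_top"
    by (rule tendsto_set_lebesgue_integral_at_top[OF _ integrable]) auto
  moreover have "\<forall>\<^sub>F b in at_top. (LINT t:{a..b}|lebesgue. f' t) = f b - f a"
    using eventually_ge_at_top[of a] by eventually_elim (rule integral_Icc)
  ultimately have "((\<lambda>b. f b - f a) \<longlongrightarrow> (LINT t:{a..}|lebesgue. f' t)) at_top"
    by (rule Lim_transform_eventually)
  then have "((\<lambda>b. f b - f a) \<longlongrightarrow> integral {a..} f') at_top"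
    by (simp add: set_lebesgue_integral_eq_integral(2)[OF integrable])
  moreover have "((\<lambda>b. f b - f a) \<longlongrightarrow> l - f a) at_top"
    by (intro tendsto_intros lim)
  ultimately have "integral {a..} f' = l - f a"
    by (rule tendsto_unique[OF trivial_limit_at_top_linorder])
  then show ?thesis
    using set_lebesgue_integral_eq_integral(1)[OF integrable] by (simp add: has_integral_iff)
qed

lemma integral_sums_absolutely_integrable:
  fixes f :: "nat \<Rightarrow> 'a::euclidean_space \<Rightarrow> 'b::euclidean_space"
  assumes measurable: "S \<in> sets lebesgue"
    and integrable: "\<And>n. f n absolutely_integrable_on S"
    and pointwise: "\<And>x. x \<in> S \<Longrightarrow> summable (\<lambda>n. norm (f n x))"
    and integrals: "summable (\<lambda>n. integral S (\<lambda>x. norm (f n x)))"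
  shows "(\<lambda>n. integral S (f n)) sums integral S (\<lambda>x. \<Sum>n. f n x)"
proof -
  note integrable' = absolutely_integrable_imp_integrable[OF integrable measurable]
  have AE_summable: "AE x in lebesgue_on S. summable (\<lambda>n. norm (f n x))"
    using pointwise by (intro AE_I2) (simp add: space_restrict_space)
  have summable_norms: "summable (\<lambda>n. \<integral>x. norm (f n x) \<partial>lebesgue_on S)"
    using integrals lebesgue_integral_eq_integral[OF integrable_norm[OF integrable'] measurable]
    by simp
  show ?thesis
    using sums_integral[OF integrable' AE_summable summable_norms]
      lebesgue_integral_eq_integral[OF integrable' measurable]
      lebesgue_integral_eq_integral[OF
        integrable_suminf[OF integrable' AE_summable summable_norms] measurable]
    by simp
qed

definition exponential_order :: "real \<Rightarrow> (real \<Rightarrow> complex) \<Rightarrow> bool" where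
  "exponential_order b f \<longleftrightarrow>
     continuous_on {0..} f \<and> (\<exists>C. \<forall>t\<ge>0. norm (f t) \<le> C * exp (b * t))"

definition laplace :: "(real \<Rightarrow> complex) \<Rightarrow> complex \<Rightarrow> complex" where
  "laplace f z = integral {0..} (\<lambda>t. f t * exp (- (z * of_real t)))"

lemma exponential_orderI:
  assumes "continuous_on {0..} f" and "\<And>t. t \<ge> 0 \<Longrightarrow> norm (f t) \<le> C * exp (b * t)"
  shows "exponential_order b f"
  using assms unfolding exponential_order_def by blast

lemma exponential_order_add:
  assumes "exponential_order b f" and "exponential_order b g"
  shows "exponential_order b (\<lambda>t. f t + g t)"
proof -
  obtain C D where "\<And>t. t \<ge> 0 \<Longrightarrow> norm (f t) \<le> C * exp (b * t)"
    and "\<And>t. t \<ge> 0 \<Longrightarrow> norm (g t) \<le> D * exp (b * t)"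
    using assms unfolding exponential_order_def by blast
  then have "norm (f t + g t) \<le> (C + D) * exp (b * t)" if "t \<ge> 0" for t
    using norm_triangle_mono that by (fastforce simp: distrib_right)
  with assms show ?thesis
    unfolding exponential_order_def by (blast intro: continuous_on_add)
qed

lemma exponential_order_cmult:
  assumes "exponential_order b f"
  shows "exponential_order b (\<lambda>t. k * f t)"
proof -
  obtain C where "\<And>t. t \<ge> 0 \<Longrightarrow> norm (f t) \<le> C * exp (b * t)"
    using assms unfolding exponential_order_def by blast
  then have "norm (k * f t) \<le> norm k * C * exp (b * t)" if "t \<ge> 0" for t
    using that by (simp add: norm_mult mult.assoc mult_left_mono)
  with assms show ?thesis
    unfolding exponential_order_def by (blast intro: continuous_on_mult_left)
qed

lemma norm_laplace_integrand_le:
  assumes "norm (f t) \<le> C * exp (b * t)"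
  shows "norm (f t * exp (- (z * of_real t))) \<le> C * exp ((b - Re z) * t)"
proof -
  have "norm (f t * exp (- (z * of_real t))) \<le> C * exp (b * t) * exp (- (Re z * t))"
    using assms by (simp add: norm_mult mult_right_mono)
  also have "\<dots> = C * exp ((b - Re z) * t)"
    by (simp add: mult.assoc flip: exp_add) (simp add: algebra_simps)
  finally show ?thesis .
qed

lemma has_integral_exp_decay:
  fixes a b :: real
  assumes "b < a"
  shows "((\<lambda>t. C * exp ((b - a) * t)) has_integral C / (a - b)) {0..}"
  using has_integral_mult_right[OF has_integral_exp_minus_to_infinity[of "a - b" 0], of C] assms
  by simp

lemma borel_measurable_laplace_integrand:
  fixes f :: "real \<Rightarrow> complex"
  assumes "continuous_on {0..} f"
  shows "(\<lambda>t. f t * exp (- (z * of_real t))) \<in> borel_measurable (lebesgue_on {0..})"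
  using assms by (intro continuous_imp_measurable_on_sets_lebesgue) (auto intro!: continuous_intros)

lemma absolutely_integrable_laplace:
  assumes "exponential_order b f" and "Re z > b"
  shows "(\<lambda>t. f t * exp (- (z * of_real t))) absolutely_integrable_on {0..}"
proof -
  obtain C where bound: "\<And>t. t \<ge> 0 \<Longrightarrow> norm (f t) \<le> C * exp (b * t)"
    using assms(1) unfolding exponential_order_def by blast
  show ?thesis
  proof (rule measurable_bounded_by_integrable_imp_absolutely_integrable)
    show "(\<lambda>t. f t * exp (- (z * of_real t))) \<in> borel_measurable (lebesgue_on {0..})"
      using assms(1) by (simp add: exponential_order_def borel_measurable_laplace_integrand)
    show "(\<lambda>t. C * exp ((b - Re z) * t)) integrable_on {0..}"
      by (rule has_integral_integrable[OF has_integral_exp_decay[OF assms(2)]])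
  qed (auto intro: norm_laplace_integrand_le bound)
qed

lemma norm_laplace_le:
  assumes "continuous_on {0..} f" and "\<And>t. t \<ge> 0 \<Longrightarrow> norm (f t) \<le> C * exp (b * t)"
    and "Re z > b"
  shows "norm (laplace f z) \<le> C / (Re z - b)"
  unfolding laplace_def
proof (rule integral_norm_bound_integral')
  show "((\<lambda>t. C * exp ((b - Re z) * t)) has_integral C / (Re z - b)) {0..}"
    by (rule has_integral_exp_decay) (rule assms)
qed (use assms in \<open>auto intro: norm_laplace_integrand_le borel_measurable_laplace_integrand\<close>)

lemma laplace_add:
  assumes "exponential_order b f" and "exponential_order b g" and "Re z > b"
  shows "laplace (\<lambda>t. f t + g t) z = laplace f z + laplace g z"
  unfolding laplace_def distrib_right
  by (intro Henstock_Kurzweil_Integration.integral_add set_lebesgue_integral_eq_integral(1)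
      absolutely_integrable_laplace[OF _ assms(3)] assms)

lemma laplace_cmult: "laplace (\<lambda>t. k * f t) z = k * laplace f z"
  by (simp add: laplace_def mult.assoc)

lemma laplace_exp_mult: "laplace (\<lambda>t. of_real (exp (- t)) * f t) z = laplace f (z + 1)"
proof -
  have "of_real (exp (- t)) * f t * exp (- (z * of_real t))
      = f t * exp (- ((z + 1) * of_real t))" for t
  proof -
    have "- ((z + 1) * of_real t) = - (z * of_real t) + of_real (- t)"
      by (simp add: distrib_right)
    then show ?thesis
      by (simp only: exp_add exp_of_real mult_ac)
  qed
  then show ?thesis
    by (simp only: laplace_def)
qed

lemma tendsto_laplace_integrand_at_top:
  assumes "exponential_order b f" and "Re z > b"
  shows "((\<lambda>t. f t * exp (- (z * of_real t))) \<longlongrightarrow> 0) at_top"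
proof -
  obtain C where bound: "\<And>t. t \<ge> 0 \<Longrightarrow> norm (f t) \<le> C * exp (b * t)"
    using assms(1) unfolding exponential_order_def by blast
  show ?thesis
  proof (rule Lim_null_comparison)
    show "\<forall>\<^sub>F t in at_top. norm (f t * exp (- (z * of_real t))) \<le> C * exp ((b - Re z) * t)"
      using eventually_ge_at_top[of 0]
      by eventually_elim (intro norm_laplace_integrand_le bound)
    show "((\<lambda>t. C * exp ((b - Re z) * t)) \<longlongrightarrow> 0) at_top"
      using assms(2) by real_asymp
  qed
qed

lemma laplace_derivative:
  assumes order_f: "exponential_order b f" and order_f': "exponential_order b f'"
    and deriv: "\<And>t. t \<ge> 0 \<Longrightarrow> (f has_vector_derivative f' t) (at t)" and Re_z: "Re z > b"
  shows "laplace f' z = z * laplace f z - f 0"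
proof -
  let ?e = "\<lambda>t. exp (- (z * of_real t))"
  have deriv_exp: "(?e has_vector_derivative - z * ?e t) (at t)" for t
    by (auto intro!: derivative_eq_intros has_vector_derivative_real_field)
  have "((\<lambda>t. (f' t + - z * f t) * ?e t) has_integral 0 - f 0 * ?e 0) {0..}"
  proof (rule has_integral_vector_derivative_atLeast)
    show "((\<lambda>t. f t * ?e t) has_vector_derivative (f' t + - z * f t) * ?e t) (at t)"
      if "t \<ge> 0" for t
      using has_vector_derivative_mult[OF deriv[OF that] deriv_exp] by (simp add: algebra_simps)
    show "(\<lambda>t. (f' t + - z * f t) * ?e t) absolutely_integrable_on {0..}"
      by (intro absolutely_integrable_laplace[OF _ Re_z] exponential_order_add
          exponential_order_cmult order_f order_f')
    show "((\<lambda>t. f t * ?e t) \<longlongrightarrow> 0) at_top"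
      by (rule tendsto_laplace_integrand_at_top[OF order_f Re_z])
  qed
  then have "laplace (\<lambda>t. f' t + - z * f t) z = - f 0"
    by (simp add: laplace_def integral_unique)
  then show ?thesis
    by (simp only: laplace_add[OF order_f' exponential_order_cmult[OF order_f] Re_z] laplace_cmult)
      (simp add: algebra_simps)
qed

lemma laplace_const:
  assumes "Re z > 0"
  shows "laplace (\<lambda>_. k) z = k / z"
proof -
  have "laplace (\<lambda>_. 0) z = z * laplace (\<lambda>_. k) z - k"
    by (rule laplace_derivative[where b = 0])
      (use assms in \<open>auto intro!: exponential_orderI[where C = "norm k"]\<close>)
  then have "z * laplace (\<lambda>_. k) z = k"
    by (simp add: laplace_def)
  moreover have "z \<noteq> 0"
    using assms by auto
  ultimately show ?thesis
    by (simp add: nonzero_eq_divide_eq mult.commute)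
qed

lemma laplace_rescale:
  assumes order: "exponential_order b f" and c_pos: "c > 0" and Re_z: "c * Re z > b"
  shows "laplace (\<lambda>t. f (t / c)) z = of_real c * laplace f (of_real c * z)"
proof -
  let ?g = "\<lambda>t. f (t / c) * exp (- (z * of_real t))"
  have image: "(\<lambda>t. c * t) ` {0..} = {0..}"
  proof (rule equalityI[OF _ subsetI])
    fix t :: real assume "t \<in> {0..}"
    then show "t \<in> (\<lambda>t. c * t) ` {0..}"
      using c_pos by (intro image_eqI[of _ _ "t / c"]) auto
  qed (use c_pos in auto)
  have "(\<lambda>t. \<bar>c\<bar> *\<^sub>R ?g (c * t)) absolutely_integrable_on {0..}"
    using absolutely_integrable_laplace[OF order, of "of_real c * z"] c_pos Re_z
    by (simp add: mult_ac)
  then have "integral ((\<lambda>t. c * t) ` {0..}) ?g = integral {0..} (\<lambda>t. \<bar>c\<bar> *\<^sub>R ?g (c * t))"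
    using has_absolute_integral_change_of_variables_real[of "{0..}" "\<lambda>t. c * t" "\<lambda>_. c" ?g] c_pos
    by (auto intro!: derivative_eq_intros simp: inj_on_def)
  then show ?thesis
    using c_pos unfolding image by (simp add: laplace_def scaleR_conv_of_real mult_ac)
qed

subsection \<open>Factorial series as Laplace transforms\<close>

definition one_minus_exp :: "real \<Rightarrow> complex" where
  "one_minus_exp t = 1 - of_real (exp (- t))"

lemma one_minus_exp_0 [simp]: "one_minus_exp 0 = 0"
  by (simp add: one_minus_exp_def)

lemma norm_one_minus_exp:
  assumes "t \<ge> 0"
  shows "norm (one_minus_exp t) = 1 - exp (- t)"
proof -
  have "one_minus_exp t = of_real (1 - exp (- t))"
    by (simp add: one_minus_exp_def)
  then show ?thesis
    using assms by (simp only: norm_of_real) simp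
qed

lemma norm_one_minus_exp_less_1: "t \<ge> 0 \<Longrightarrow> norm (one_minus_exp t) < 1"
  by (simp add: norm_one_minus_exp)

lemma has_vector_derivative_one_minus_exp:
  "(one_minus_exp has_vector_derivative of_real (exp (- t))) (at t)"
proof -
  have "((\<lambda>t. 1 - exp (- t)) has_real_derivative exp (- t)) (at t)"
    by (auto intro!: derivative_eq_intros)
  from has_vector_derivative_of_real[OF this, where 'a = complex] show ?thesis
    by (simp add: one_minus_exp_def[abs_def])
qed

lemma continuous_on_one_minus_exp: "continuous_on S one_minus_exp"
  unfolding one_minus_exp_def by (intro continuous_intros)

lemma exponential_order_one_minus_exp_power:
  "exponential_order 0 (\<lambda>t. one_minus_exp t ^ n)"
  by (rule exponential_orderI[where C = 1])
    (auto intro!: continuous_intros continuous_on_one_minus_exp power_le_one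
      simp: norm_power norm_one_minus_exp)

lemma laplace_one_minus_exp_power_Suc:
  assumes "Re z > 0"
  shows "z * laplace (\<lambda>t. one_minus_exp t ^ Suc n) z
           = of_nat (Suc n) * laplace (\<lambda>t. one_minus_exp t ^ n) (z + 1)"
proof -
  let ?u = one_minus_exp
  let ?u' = "\<lambda>t. of_nat (Suc n) * (of_real (exp (- t)) * ?u t ^ n)"
  have "laplace ?u' z = z * laplace (\<lambda>t. ?u t ^ Suc n) z - ?u 0 ^ Suc n"
  proof (rule laplace_derivative[OF exponential_order_one_minus_exp_power])
    show "exponential_order 0 ?u'"
    proof (intro exponential_order_cmult exponential_orderI[where C = 1])
      show "continuous_on {0..} (\<lambda>t. of_real (exp (- t)) * ?u t ^ n)"
        by (intro continuous_intros continuous_on_one_minus_exp)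
      show "norm (of_real (exp (- t)) * ?u t ^ n) \<le> 1 * exp (0 * t)" if "t \<ge> 0" for t
        using that by (simp add: norm_mult norm_power norm_one_minus_exp mult_le_one power_le_one)
    qed
    show "((\<lambda>t. ?u t ^ Suc n) has_vector_derivative ?u' t) (at t)" for t
    proof -
      have "((\<lambda>x. x ^ Suc n) has_field_derivative of_nat (Suc n) * ?u t ^ n) (at (?u t))"
        by (rule derivative_eq_intros refl | simp)+
      from field_vector_diff_chain_at[OF has_vector_derivative_one_minus_exp this] show ?thesis
        by (simp add: o_def mult_ac del: of_nat_Suc power_Suc)
    qed
  qed (rule assms)
  then show ?thesis
    by (simp only: laplace_cmult laplace_exp_mult one_minus_exp_0 power_0_Suc diff_zero)
qed

lemma laplace_one_minus_exp_power:
  assumes "Re z > 0"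
  shows "laplace (\<lambda>t. one_minus_exp t ^ n) z = fact n / pochhammer z (Suc n)"
  using assms
proof (induction n arbitrary: z)
  case 0
  then show ?case
    by (simp add: laplace_const)
next
  case (Suc n)
  let ?L = "laplace (\<lambda>t. one_minus_exp t ^ Suc n) z"
  have "z * ?L = of_nat (Suc n) * (fact n / pochhammer (z + 1) (Suc n))"
    unfolding laplace_one_minus_exp_power_Suc[OF Suc.prems]
    using Suc.IH[of "z + 1"] Suc.prems by simp
  also have "\<dots> = fact (Suc n) / pochhammer (z + 1) (Suc n)"
    by simp
  finally have "z * ?L / z = fact (Suc n) / (z * pochhammer (z + 1) (Suc n))"
    by (simp only: divide_divide_eq_left mult.commute[of z])
  moreover have "z \<noteq> 0"
    using Suc.prems by auto
  ultimately show ?case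
    unfolding pochhammer_rec[of z "Suc n"] by (metis nonzero_mult_div_cancel_left)
qed

lemma integral_norm_one_minus_exp_power:
  assumes "Re z > 0"
  shows "integral {0..} (\<lambda>t. norm (one_minus_exp t ^ n * exp (- (z * of_real t))))
           = norm (fact n / pochhammer (of_real (Re z) :: complex) (Suc n))"
proof -
  let ?g = "\<lambda>t. norm (one_minus_exp t ^ n * exp (- (z * of_real t)))"
  have "?g integrable_on {0..}"
    using absolutely_integrable_laplace[OF exponential_order_one_minus_exp_power assms]
    by (simp add: absolutely_integrable_on_def)
  then have "((\<lambda>t. of_real (?g t)) has_integral (of_real (integral {0..} ?g) :: complex)) {0..}"
    by (intro has_integral_of_real integrable_integral)
  moreover have "of_real (?g t) = one_minus_exp t ^ n * exp (- (of_real (Re z) * of_real t))"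
    if "t \<in> {0..}" for t
    using that by (simp add: norm_mult norm_power norm_one_minus_exp)
      (simp add: one_minus_exp_def exp_of_real[symmetric])
  ultimately have "((\<lambda>t. one_minus_exp t ^ n * exp (- (of_real (Re z) * of_real t))) has_integral
      (of_real (integral {0..} ?g) :: complex)) {0..}"
    by (rule has_integral_eq[rotated])
  then have "of_real (integral {0..} ?g) = laplace (\<lambda>t. one_minus_exp t ^ n) (of_real (Re z))"
    by (simp add: laplace_def integral_unique)
  also have "\<dots> = fact n / pochhammer (of_real (Re z)) (Suc n)"
    using assms by (intro laplace_one_minus_exp_power) simp
  finally have "norm (complex_of_real (integral {0..} ?g))
      = norm (fact n / pochhammer (of_real (Re z) :: complex) (Suc n))"
    by (rule arg_cong)
  moreover have "integral {0..} ?g \<ge> 0"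
    by (intro integral_nonneg \<open>?g integrable_on {0..}\<close>) simp
  ultimately show ?thesis
    by (simp only: norm_of_real abs_of_nonneg)
qed

lemma laplace_power_series_one_minus_exp:
  assumes Re_z: "Re z > 0"
    and conv_radius: "conv_radius c \<ge> 1"
    and factorial_series:
      "summable (\<lambda>n. norm (c n * (fact n / pochhammer (of_real (Re z)) (Suc n))))"
  shows "(\<lambda>n. c n * (fact n / pochhammer z (Suc n))) sums
           laplace (\<lambda>t. \<Sum>n. c n * one_minus_exp t ^ n) z"
proof -
  let ?e = "\<lambda>t. exp (- (z * of_real t))"
  have summable: "summable (\<lambda>n. norm (c n * one_minus_exp t ^ n))" if "t \<ge> 0" for t
    using norm_one_minus_exp_less_1[OF that]
    by (intro abs_summable_in_conv_radius less_le_trans[OF _ conv_radius]) (simp add: one_ereal_def)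
  have "(\<lambda>n. integral {0..} (\<lambda>t. c n * one_minus_exp t ^ n * ?e t)) sums
          integral {0..} (\<lambda>t. \<Sum>n. c n * one_minus_exp t ^ n * ?e t)"
  proof (rule integral_sums_absolutely_integrable)
    show "(\<lambda>t. c n * one_minus_exp t ^ n * ?e t) absolutely_integrable_on {0..}" for n
      by (intro absolutely_integrable_laplace[OF _ Re_z] exponential_order_cmult
          exponential_order_one_minus_exp_power)
    show "summable (\<lambda>n. norm (c n * one_minus_exp t ^ n * ?e t))" if "t \<in> {0..}" for t
      using summable_mult2[OF summable, of t "norm (?e t)"] that
      by (simp only: norm_mult atLeast_iff)
    have "integral {0..} (\<lambda>t. norm (c n * one_minus_exp t ^ n * ?e t))
        = norm (c n * (fact n / pochhammer (of_real (Re z)) (Suc n)))" for n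
      using integral_norm_one_minus_exp_power[OF Re_z, of n]
      by (simp only: norm_mult mult.assoc Henstock_Kurzweil_Integration.integral_mult_right)
    then show "summable (\<lambda>n. integral {0..} (\<lambda>t. norm (c n * one_minus_exp t ^ n * ?e t)))"
      using factorial_series by (simp only:)
  qed simp
  moreover have "integral {0..} (\<lambda>t. c n * one_minus_exp t ^ n * ?e t)
      = c n * (fact n / pochhammer z (Suc n))" for n
    using laplace_cmult[of "c n" "\<lambda>t. one_minus_exp t ^ n" z]
      laplace_one_minus_exp_power[OF Re_z, of n]
    by (simp only: laplace_def)
  moreover have "(\<Sum>n. c n * one_minus_exp t ^ n * ?e t) = (\<Sum>n. c n * one_minus_exp t ^ n) * ?e t"
    if "t \<in> {0..}" for t
    using that by (intro suminf_mult2[symmetric] summable_norm_cancel[OF summable]) simp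
  then have "integral {0..} (\<lambda>t. \<Sum>n. c n * one_minus_exp t ^ n * ?e t)
      = laplace (\<lambda>t. \<Sum>n. c n * one_minus_exp t ^ n) z"
    unfolding laplace_def by (rule integral_cong)
  ultimately show ?thesis
    by (simp only:)
qed

lemma fact_div_pochhammer_bigo:
  fixes z :: complex
  assumes "z \<notin> \<int>\<^sub>\<le>\<^sub>0"
  shows "(\<lambda>n. norm (fact n / pochhammer z (Suc n))) \<in> O(\<lambda>n. real n powr - Re z)"
proof (rule bigoI_tendsto)
  have "norm (Gamma_series z n) = norm (fact n / pochhammer z (Suc n)) / real n powr - Re z"
    if "n > 0" for n
    using that
    by (simp add: Gamma_series_def norm_mult norm_divide powr_def exp_minus field_simps)
  then have "\<forall>\<^sub>F n in sequentially.
      norm (Gamma_series z n) = norm (fact n / pochhammer z (Suc n)) / real n powr - Re z"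
    using eventually_gt_at_top[of 0] by (rule eventually_mono[rotated])
  moreover have "(\<lambda>n. norm (Gamma_series z n)) \<longlonglongrightarrow> norm (Gamma z)"
    by (intro tendsto_norm Gamma_series_LIMSEQ)
  ultimately show "(\<lambda>n. norm (fact n / pochhammer z (Suc n)) / real n powr - Re z)
      \<longlonglongrightarrow> norm (Gamma z)"
    by (rule Lim_transform_eventually[rotated])
  show "\<forall>\<^sub>F n in sequentially. real n powr - Re z \<noteq> 0"
    using eventually_gt_at_top[of 0] by eventually_elim simp
qed

lemma summable_factorial_series:
  fixes z :: complex
  assumes coeffs: "(\<lambda>n. norm (c n)) \<in> O(\<lambda>n. real n powr (b - 1))"
    and exponent: "b > 0" "b < Re z"
  shows "summable (\<lambda>n. norm (c n * (fact n / pochhammer z (Suc n))))"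
proof (rule summable_comparison_test_bigo)
  have "z \<notin> \<int>\<^sub>\<le>\<^sub>0"
    using exponent by (auto elim!: nonpos_Ints_cases)
  from landau_o.big.mult[OF coeffs fact_div_pochhammer_bigo[OF this]]
  show "(\<lambda>n. norm (c n * (fact n / pochhammer z (Suc n)))) \<in> O(\<lambda>n. real n powr (b - 1 - Re z))"
    by (simp add: norm_mult norm_divide powr_add[symmetric])
  show "summable (\<lambda>n. norm (real n powr (b - 1 - Re z)))"
    using exponent by (simp add: summable_real_powr_iff)
qed

subsection \<open>Taylor coefficients and growth at the boundary\<close>

lemma norm_higher_deriv_le_circle_integral:
  assumes holomorphic: "f holomorphic_on ball z R" and radius: "0 < r" "r < R"
    and integrable: "k integrable_on {0..1}"
    and bound: "\<And>t. t \<in> {0..1} \<Longrightarrow> norm (f (circlepath z r t)) \<le> k t"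
  shows "norm ((deriv ^^ n) f z) / fact n \<le> integral {0..1} k / r ^ n"
proof -
  let ?p = "circlepath z r"
  define g where
    "g t = f (?p t) / (?p t - z) ^ Suc n * vector_derivative ?p (at t within {0..1})" for t
  have "cball z r \<subseteq> ball z R"
    using radius by auto
  then have "((\<lambda>u. f u / (u - z) ^ Suc n) has_contour_integral
      2 * pi * \<i> / fact n * (deriv ^^ n) f z) ?p"
    using radius by (intro Cauchy_has_contour_integral_higher_derivative_circlepath
        continuous_on_subset[OF holomorphic_on_imp_continuous_on[OF holomorphic]]
        holomorphic_on_subset[OF holomorphic]) auto
  then have has_integral_g: "(g has_integral 2 * pi * \<i> / fact n * (deriv ^^ n) f z) {0..1}"
    unfolding has_contour_integral_def g_def .
  have "norm (g t) = 2 * pi / r ^ n * norm (f (?p t))" if "t \<in> {0..1}" for t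
  proof -
    have "norm (?p t - z) = r"
      using radius by (simp add: circlepath norm_mult)
    moreover have "norm (vector_derivative ?p (at t within {0..1})) = 2 * pi * r"
      using that radius by (simp add: vector_derivative_circlepath01 norm_mult)
    ultimately show ?thesis
      using radius by (simp add: g_def norm_mult norm_divide norm_power)
  qed
  then have "norm (g t) \<le> 2 * pi / r ^ n * k t" if "t \<in> {0..1}" for t
    using that radius mult_left_mono[OF bound[OF that], of "2 * pi / r ^ n"] by simp
  then have "norm (integral {0..1} g) \<le> integral {0..1} (\<lambda>t. 2 * pi / r ^ n * k t)"
    using has_integral_g
    by (intro integral_norm_bound_integral integrable_on_mult_right integrable) auto
  then have "2 * pi * (norm ((deriv ^^ n) f z) / fact n) \<le> 2 * pi * (integral {0..1} k / r ^ n)"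
    by (simp add: integral_unique[OF has_integral_g] norm_mult norm_divide)
  then show ?thesis
    by (rule mult_left_le_imp_le) simp
qed

lemma norm_one_minus_circlepath_squared:
  "(norm (1 - circlepath 0 r t))\<^sup>2 = (1 - r)\<^sup>2 + 4 * r * (sin (pi * t))\<^sup>2"
proof -
  have "circlepath 0 r t = of_real r * cis (2 * (pi * t))"
    by (simp add: circlepath cis_conv_exp mult_ac)
  then have "(norm (1 - circlepath 0 r t))\<^sup>2
      = (1 - r * cos (2 * (pi * t)))\<^sup>2 + (r * sin (2 * (pi * t)))\<^sup>2"
    by (simp add: cmod_power2)
  also have "\<dots> = 1 - 2 * r * cos (2 * (pi * t))
      + r\<^sup>2 * ((sin (2 * (pi * t)))\<^sup>2 + (cos (2 * (pi * t)))\<^sup>2)"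
    by algebra
  also have "\<dots> = 1 - 2 * r * cos (2 * (pi * t)) + r\<^sup>2"
    by simp
  also have "\<dots> = (1 - r)\<^sup>2 + 4 * r * (sin (pi * t))\<^sup>2"
    unfolding cos_double_sin by algebra
  finally show ?thesis .
qed

lemma sin_ge_chord:
  fixes x :: real
  assumes "0 \<le> x" and "x \<le> 1 / 2"
  shows "2 * x \<le> sin (pi * x)"
proof -
  have "concave_on {0..pi/2} sin"
    by (rule f''_le0_imp_concave[where f' = cos and f'' = "\<lambda>x. - sin x"])
      (auto intro!: derivative_eq_intros sin_ge_zero)
  from concave_onD[OF this, of "2 * x" 0 "pi/2"] assms show ?thesis
    by (simp add: mult.commute)
qed

lemma sin_ge_min_chord:
  fixes t :: real
  assumes "0 \<le> t" and "t \<le> 1"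
  shows "2 * min t (1 - t) \<le> sin (pi * t)"
proof (cases "t \<le> 1 / 2")
  case True
  then show ?thesis
    using assms sin_ge_chord[of t] by (simp add: min_def)
next
  case False
  have "sin (pi * (1 - t)) = sin (pi - pi * t)"
    by (simp add: right_diff_distrib)
  with False show ?thesis
    using assms sin_ge_chord[of "1 - t"] by (simp add: min_def)
qed

lemma norm_one_minus_circlepath_ge:
  assumes radius: "1 / 2 \<le> r" "r \<le> 1" and param: "0 \<le> t" "t \<le> 1"
  shows "(1 - r + min t (1 - t)) / 2 \<le> norm (1 - circlepath 0 r t)"
proof (rule power2_le_imp_le)
  define m where "m = min t (1 - t)"
  have "m \<ge> 0"
    using param by (simp add: m_def)
  have "((x + m) / 2)\<^sup>2 \<le> x\<^sup>2 + m\<^sup>2" for x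
    using sum_squares_bound[of x m]
    by (simp add: power_divide power2_sum) (smt (verit) zero_le_power2)
  then have "((1 - r + m) / 2)\<^sup>2 \<le> (1 - r)\<^sup>2 + m\<^sup>2" .
  also have "\<dots> \<le> (1 - r)\<^sup>2 + 4 * r * (2 * m)\<^sup>2"
  proof -
    have "1 * m\<^sup>2 \<le> (16 * r) * m\<^sup>2"
      using radius by (intro mult_right_mono) auto
    then show ?thesis
      by (simp add: power_mult_distrib)
  qed
  also have "\<dots> \<le> (1 - r)\<^sup>2 + 4 * r * (sin (pi * t))\<^sup>2"
    using sin_ge_min_chord[OF param] \<open>m \<ge> 0\<close> radius unfolding m_def[symmetric]
    by (intro add_left_mono mult_left_mono power_mono) auto
  also have "\<dots> = (norm (1 - circlepath 0 r t))\<^sup>2"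
    by (rule norm_one_minus_circlepath_squared[symmetric])
  finally show "((1 - r + min t (1 - t)) / 2)\<^sup>2 \<le> (norm (1 - circlepath 0 r t))\<^sup>2"
    by (simp only: m_def)
qed simp

lemma norm_one_minus_circlepath_powr_le:
  assumes radius: "1 / 2 \<le> r" "r < 1" and param: "0 \<le> t" "t \<le> 1" and exponent: "b \<ge> 0"
  shows "norm (1 - circlepath 0 r t) powr - b
           \<le> 2 powr b * ((1 - r + t) powr - b + (1 - r + (1 - t)) powr - b)"
proof -
  define m where "m = 1 - r + min t (1 - t)"
  have "m > 0"
    using radius param by (simp add: m_def)
  have "norm (1 - circlepath 0 r t) powr - b \<le> (m / 2) powr - b"
    using norm_one_minus_circlepath_ge[of r t] radius param exponent \<open>m > 0\<close>
    by (intro powr_mono2') (auto simp: m_def)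
  also have "\<dots> = 2 powr b * m powr - b"
    using \<open>m > 0\<close> by (simp add: powr_divide powr_minus field_simps)
  also have "m powr - b \<le> (1 - r + t) powr - b + (1 - r + (1 - t)) powr - b"
    by (simp add: m_def min_def)
  finally show ?thesis
    by simp
qed

lemma has_integral_powr_boundary_kernel:
  fixes d b :: real
  assumes "d > 0" and "b \<noteq> 1"
  shows "((\<lambda>t. (d + t) powr - b + (d + (1 - t)) powr - b) has_integral
           2 * (d powr (1 - b) - (d + 1) powr (1 - b)) / (b - 1)) {0..1}"
proof -
  define G where "G t = ((d + (1 - t)) powr (1 - b) - (d + t) powr (1 - b)) / (b - 1)" for t
  have "((\<lambda>t. (d + t) powr - b + (d + (1 - t)) powr - b) has_integral G 1 - G 0) {0..1}"
  proof (rule fundamental_theorem_of_calculus)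
    fix t :: real assume "t \<in> {0..1}"
    then have "(G has_real_derivative
        ((1 - b) * (d + (1 - t)) powr - b * - 1 - (1 - b) * (d + t) powr - b) / (b - 1))
        (at t within {0..1})"
      unfolding G_def using assms by (auto intro!: derivative_eq_intros)
    also have "((1 - b) * (d + (1 - t)) powr - b * - 1 - (1 - b) * (d + t) powr - b) / (b - 1)
        = (d + t) powr - b + (d + (1 - t)) powr - b"
      using assms(2) by (simp add: divide_simps) algebra
    finally have "(G has_real_derivative (d + t) powr - b + (d + (1 - t)) powr - b)
        (at t within {0..1})" .
    then show "(G has_vector_derivative (d + t) powr - b + (d + (1 - t)) powr - b)
        (at t within {0..1})"
      by (simp add: has_real_derivative_iff_has_vector_derivative)
  qed simp
  also have "G 1 - G 0 = 2 * (d powr (1 - b) - (d + 1) powr (1 - b)) / (b - 1)"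
    by (simp add: G_def diff_divide_distrib)
  finally show ?thesis .
qed

lemma norm_higher_deriv_le_powr:
  assumes holomorphic: "f holomorphic_on ball 0 1" and exponent: "b > 1" and M_nonneg: "M \<ge> 0"
    and growth: "\<And>u. u \<in> ball 0 1 \<Longrightarrow> norm (f u) \<le> M * norm (1 - u) powr - b"
    and radius: "1 / 2 \<le> r" "r < 1"
  shows "norm ((deriv ^^ n) f 0) / fact n
           \<le> M * 2 powr b * (2 * (1 - r) powr (1 - b) / (b - 1)) / r ^ n"
proof -
  define k where "k t = (1 - r + t) powr - b + (1 - r + (1 - t)) powr - b" for t
  have has_integral_k:
    "(k has_integral 2 * ((1 - r) powr (1 - b) - (1 - r + 1) powr (1 - b)) / (b - 1)) {0..1}"
    unfolding k_def using radius exponent by (intro has_integral_powr_boundary_kernel) auto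
  have "norm ((deriv ^^ n) f 0) / fact n \<le> integral {0..1} (\<lambda>t. M * 2 powr b * k t) / r ^ n"
  proof (rule norm_higher_deriv_le_circle_integral[OF holomorphic])
    fix t :: real assume param: "t \<in> {0..1}"
    have "circlepath 0 r t \<in> ball 0 1"
      using radius by (simp add: circlepath norm_mult)
    then have "norm (f (circlepath 0 r t)) \<le> M * norm (1 - circlepath 0 r t) powr - b"
      by (rule growth)
    also have "\<dots> \<le> M * (2 powr b * k t)"
      unfolding k_def using param radius exponent
      by (intro mult_left_mono norm_one_minus_circlepath_powr_le M_nonneg) auto
    finally show "norm (f (circlepath 0 r t)) \<le> M * 2 powr b * k t"
      by (simp only: mult.assoc)
  qed (use radius has_integral_k in \<open>auto intro!: integrable_on_mult_right\<close>)
  also have "\<dots> = M * 2 powr b * integral {0..1} k / r ^ n"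
    by simp
  also have "\<dots> \<le> M * 2 powr b * (2 * (1 - r) powr (1 - b) / (b - 1)) / r ^ n"
    using exponent radius M_nonneg by (intro divide_right_mono mult_left_mono)
      (auto simp: integral_unique[OF has_integral_k] intro!: divide_right_mono)
  finally show ?thesis .
qed

text \<open>Cauchy's estimate with the supremum over a circle would only give \<open>O(n\<^sup>b)\<close>; the factor
  \<open>n\<close> is recovered by integrating the bound over the circle of radius \<open>n / (n + 1)\<close>.\<close>

lemma higher_deriv_bigo_powr:
  assumes holomorphic: "f holomorphic_on ball 0 1" and exponent: "b > 1"
    and growth: "\<And>u. u \<in> ball 0 1 \<Longrightarrow> norm (f u) \<le> M * norm (1 - u) powr - b"
  shows "(\<lambda>n. norm ((deriv ^^ n) f 0 / fact n)) \<in> O(\<lambda>n. real n powr (b - 1))"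
proof (rule bigoI, rule eventually_mono[OF eventually_gt_at_top])
  define C where "C = M * 2 powr b * (2 * 2 powr (b - 1) / (b - 1)) * exp 1"
  fix n :: nat assume n_pos: "n > 0"
  define r where "r = real n / (real n + 1)"
  have radius: "1 / 2 \<le> r" "r < 1" and one_minus_r: "1 - r = 1 / (real n + 1)"
    and inverse_r: "1 / r = 1 + 1 / real n"
    using n_pos by (auto simp: r_def field_simps)
  have M_nonneg: "M \<ge> 0"
    using order_trans[OF norm_ge_zero growth[of 0]] by simp
  have "(1 - r) powr (1 - b) = (real n + 1) powr (b - 1)"
    unfolding one_minus_r by (simp add: powr_divide powr_minus_divide[of _ "b - 1", simplified])
  also have "\<dots> \<le> (2 * real n) powr (b - 1)"
    using n_pos exponent by (intro powr_mono2) auto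
  finally have powr_le: "(1 - r) powr (1 - b) \<le> 2 powr (b - 1) * real n powr (b - 1)"
    by (simp add: powr_mult)
  have "1 / r ^ n = (1 + 1 / real n) ^ n"
    by (metis inverse_r power_one_over)
  also have "\<dots> \<le> exp 1"
    using n_pos by (intro exp_ge_one_plus_x_over_n_power_n) auto
  finally have power_le: "1 / r ^ n \<le> exp 1" .
  have "norm ((deriv ^^ n) f 0) / fact n
      \<le> M * 2 powr b * (2 * (1 - r) powr (1 - b) / (b - 1)) * (1 / r ^ n)"
    using norm_higher_deriv_le_powr[OF holomorphic exponent M_nonneg growth radius, of n] by simp
  also have "\<dots> \<le> M * 2 powr b * (2 * (2 powr (b - 1) * real n powr (b - 1)) / (b - 1)) * exp 1"
    using M_nonneg exponent radius
    by (intro mult_mono mult_left_mono divide_right_mono powr_le power_le) auto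
  finally show "norm (norm ((deriv ^^ n) f 0 / fact n)) \<le> C * norm (real n powr (b - 1))"
    by (simp add: C_def norm_divide mult_ac)
qed

subsection \<open>Functions of logarithmic growth on the unit disc\<close>

lemma norm_Ln_one_plus_le:
  fixes v :: complex
  assumes "norm v < 1"
  shows "norm (Ln (1 + v)) \<le> - ln (1 - norm v)"
proof -
  have Ln_sums: "(\<lambda>n. - ((- v) ^ n) / of_nat n) sums Ln (1 + v)"
    using Ln_series'[OF assms] by simp
  have "(\<lambda>n. - ((- (- norm v)) ^ n) / real n) sums ln (1 + - norm v)"
    by (rule ln_series') (use assms in auto)
  from sums_minus[OF this] have ln_sums: "(\<lambda>n. norm v ^ n / real n) sums - ln (1 - norm v)"
    by simp
  have "norm (\<Sum>n. - ((- v) ^ n) / of_nat n) \<le> (\<Sum>n. norm v ^ n / real n)"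
    by (rule norm_suminf_le[OF _ sums_summable[OF ln_sums]]) (simp add: norm_divide norm_power)
  then show ?thesis
    using Ln_sums ln_sums by (simp add: sums_iff)
qed

lemma norm_Ln_scaled_one_plus_le:
  fixes v :: complex
  assumes scale: "0 < s" "s \<le> 1" and norm_v: "norm v < 1"
  shows "norm (Ln (of_real s * (1 + v))) \<le> - ln (s * (1 - norm v))"
proof -
  have "1 + v \<noteq> 0"
    using norm_v by (metis add_eq_0_iff norm_minus_cancel norm_one order_less_irrefl)
  then have "Ln (of_real s * (1 + v)) = of_real (ln s) + Ln (1 + v)"
    using scale by (simp add: Ln_times_of_real Ln_of_real)
  then have "norm (Ln (of_real s * (1 + v))) \<le> \<bar>ln s\<bar> + norm (Ln (1 + v))"
    by (metis norm_triangle_ineq norm_of_real)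
  also have "\<dots> \<le> - ln s + - ln (1 - norm v)"
    using scale norm_Ln_one_plus_le[OF norm_v] by simp
  also have "\<dots> = - ln (s * (1 - norm v))"
    using scale norm_v by (simp add: ln_mult)
  finally show ?thesis .
qed

lemma norm_Ln_le:
  assumes "s \<noteq> 0"
  shows "norm (Ln s) \<le> \<bar>ln (norm s)\<bar> + pi"
proof -
  have "norm (Ln s) \<le> \<bar>Re (Ln s)\<bar> + \<bar>Im (Ln s)\<bar>"
    by (rule cmod_le)
  also have "\<dots> \<le> \<bar>ln (norm s)\<bar> + pi"
    using Im_Ln_le_pi[OF assms] mpi_less_Im_Ln[OF assms] assms by simp
  finally show ?thesis .
qed

lemma Gamma_quotient_conv_pochhammer:
  fixes z :: complex
  assumes "Re z > 0"
  shows "Gamma z * Gamma (of_nat n + 1) / Gamma (z + of_nat n + 1) = fact n / pochhammer z (Suc n)"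
proof -
  have "z \<notin> \<int>\<^sub>\<le>\<^sub>0"
    using assms by (auto elim!: nonpos_Ints_cases)
  moreover have "Gamma (of_nat n + 1 :: complex) = fact n"
    by (simp add: Gamma_fact add.commute)
  ultimately show ?thesis
    by (simp add: pochhammer_Gamma add_ac)
qed

lemma R_fact_1_conv_pochhammer:
  assumes "c \<ge> 0" and "Re z > c"
  shows "R_fact 1 A c N z
           = A / c powr c * ((real N + c + 1) powr (real N + c + 1) / (real N + 1) ^ N)
             * (fact N / (norm (pochhammer z (Suc N)) * (Re z - c)))"
proof -
  have "Gamma z * Gamma (of_nat N + 1) / (Gamma (z + of_nat N + 1) * of_real (Re z - c))
      = fact N / pochhammer z (Suc N) / of_real (Re z - c)"
    using assms by (subst Gamma_quotient_conv_pochhammer[symmetric]) auto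
  then have "norm (Gamma z * Gamma (of_nat N + 1)
        / (Gamma (z + of_nat N + 1) * of_real (Re z - c)))
      = fact N / (norm (pochhammer z (Suc N)) * (Re z - c))"
    using assms(2) by (simp add: norm_mult norm_divide del: of_real_diff)
  then show ?thesis
    by (simp only: R_fact_def of_real_1 mult_1)
qed

text \<open>This \<open>\<rho>\<close> minimises \<open>(1 - \<rho>) powr - c / \<rho> ^ n\<close> over \<open>0 < \<rho> < 1\<close>.\<close>

lemma optimal_cauchy_radius:
  fixes c :: real
  assumes c_pos: "c > 0" and n_pos: "n > 0"
  defines "\<rho> \<equiv> real n / (real n + c)"
  shows "0 < \<rho>" and "\<rho> < 1"
    and "(1 - \<rho>) powr - c / \<rho> ^ n = (real n + c) powr (real n + c) / (c powr c * real n ^ n)"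
proof -
  define q where "q = real n + c"
  have q_pos: "q > 0"
    using c_pos by (simp add: q_def)
  show "0 < \<rho>" "\<rho> < 1"
    using c_pos n_pos by (auto simp: \<rho>_def)
  have "1 - \<rho> = c / q"
    using q_pos by (simp add: \<rho>_def q_def field_simps)
  then have "(1 - \<rho>) powr - c = q powr c / c powr c"
    using q_pos c_pos by (simp add: powr_divide powr_minus)
  moreover have "\<rho> ^ n = real n ^ n / q powr real n"
    using q_pos by (simp add: \<rho>_def q_def[symmetric] power_divide powr_realpow)
  moreover have "q powr c * q powr real n = q powr q"
    by (simp add: q_def add.commute flip: powr_add)
  ultimately show "(1 - \<rho>) powr - c / \<rho> ^ n
      = (real n + c) powr (real n + c) / (c powr c * real n ^ n)"
    by (simp add: q_def[symmetric])
qed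

locale log_growth =
  fixes f :: "complex \<Rightarrow> complex" and A c :: real
  assumes holomorphic: "f holomorphic_on ball 0 1"
    and c_nonneg: "c \<ge> 0"
    and growth: "\<And>u. u \<in> ball 0 1 \<Longrightarrow> norm (f u) \<le> A * exp (c * norm (Ln (1 - u)))"
begin

lemma A_nonneg: "A \<ge> 0"
  using order_trans[OF norm_ge_zero growth[of 0]] by simp

lemma growth_powr:
  assumes exponent: "b \<ge> c" and in_disc: "u \<in> ball 0 1"
  shows "norm (f u) \<le> A * exp (b * (2 * ln 2 + pi)) * norm (1 - u) powr - b"
proof -
  have "norm (1 - u) < 2"
    using in_disc norm_triangle_ineq4[of 1 u] by simp
  moreover have "1 - u \<noteq> 0"
    using in_disc by auto
  ultimately have "ln (norm (1 - u)) \<le> ln 2"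
    by simp
  moreover have "ln (2 :: real) \<ge> 0"
    by simp
  ultimately have "norm (Ln (1 - u)) \<le> 2 * ln 2 + pi - ln (norm (1 - u))"
    using norm_Ln_le[OF \<open>1 - u \<noteq> 0\<close>] by linarith
  then have "c * norm (Ln (1 - u)) \<le> b * (2 * ln 2 + pi - ln (norm (1 - u)))"
    using exponent c_nonneg by (intro mult_mono) auto
  then have "norm (f u) \<le> A * exp (b * (2 * ln 2 + pi - ln (norm (1 - u))))"
    using growth[OF in_disc] A_nonneg by (meson exp_le_cancel_iff mult_left_mono order_trans)
  also have "\<dots> = A * exp (b * (2 * ln 2 + pi)) * norm (1 - u) powr - b"
    using \<open>1 - u \<noteq> 0\<close> by (simp add: powr_def right_diff_distrib exp_diff exp_minus divide_inverse)
  finally show ?thesis .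
qed

lemma norm_higher_deriv_le:
  assumes scale: "0 < s" "s \<le> 1" and radius: "0 < \<rho>" "\<rho> < 1"
  shows "norm ((deriv ^^ n) f (1 - of_real s))
           \<le> fact n * (A * (s * (1 - \<rho>)) powr - c) / (\<rho> * s) ^ n"
proof (rule Cauchy_inequality)
  have "norm (1 - of_real s :: complex) = 1 - s"
    using scale by (metis abs_of_nonneg diff_ge_0_iff_ge norm_of_real of_real_1 of_real_diff)
  moreover have "\<rho> * s < s"
    using scale radius by simp
  ultimately have disc: "cball (1 - of_real s) (\<rho> * s) \<subseteq> ball (0 :: complex) 1"
    by (simp add: cball_subset_ball_iff dist_norm)
  then show "f holomorphic_on ball (1 - of_real s) (\<rho> * s)"
    using holomorphic_on_subset[OF holomorphic] ball_subset_cball by blast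
  show "continuous_on (cball (1 - of_real s) (\<rho> * s)) f"
    by (rule continuous_on_subset[OF holomorphic_on_imp_continuous_on[OF holomorphic] disc])
  show "0 < \<rho> * s"
    using scale radius by simp
  fix u :: complex assume on_circle: "norm (1 - of_real s - u) = \<rho> * s"
  define v where "v = (1 - of_real s - u) / of_real s"
  have v_props: "norm v = \<rho>" "1 - u = of_real s * (1 + v)"
    using on_circle scale by (auto simp: v_def norm_divide field_simps)
  have "u \<in> ball 0 1"
    using disc on_circle by (auto simp: dist_norm subset_iff)
  then have "norm (f u) \<le> A * exp (c * norm (Ln (1 - u)))"
    by (rule growth)
  also have "\<dots> \<le> A * exp (c * - ln (s * (1 - \<rho>)))"
    using norm_Ln_scaled_one_plus_le[OF scale, of v] v_props radius A_nonneg c_nonneg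
    by (intro mult_left_mono iffD2[OF exp_le_cancel_iff]) auto
  also have "\<dots> = A * (s * (1 - \<rho>)) powr - c"
    using scale radius by (simp add: powr_def)
  finally show "norm (f u) \<le> A * (s * (1 - \<rho>)) powr - c" .
qed

definition scaled_deriv :: "nat \<Rightarrow> real \<Rightarrow> complex" where
  "scaled_deriv n t = of_real (exp (- t)) ^ n * (deriv ^^ n) f (one_minus_exp t)"

lemma scaled_deriv_0: "scaled_deriv 0 t = f (one_minus_exp t)"
  by (simp add: scaled_deriv_def)

lemma scaled_deriv_at_0: "scaled_deriv n 0 = (deriv ^^ n) f 0"
  by (simp add: scaled_deriv_def)

lemma norm_scaled_deriv_le:
  assumes t_nonneg: "t \<ge> 0" and radius: "0 < \<rho>" "\<rho> < 1"
  shows "norm (scaled_deriv n t) \<le> fact n * A * (1 - \<rho>) powr - c / \<rho> ^ n * exp (c * t)"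
proof -
  define s where "s = exp (- t)"
  have scale: "0 < s" "s \<le> 1"
    using t_nonneg by (auto simp: s_def)
  have "norm (scaled_deriv n t) = s ^ n * norm ((deriv ^^ n) f (1 - of_real s))"
    by (simp add: scaled_deriv_def one_minus_exp_def s_def norm_mult norm_power)
  also have "\<dots> \<le> s ^ n * (fact n * (A * (s * (1 - \<rho>)) powr - c) / (\<rho> * s) ^ n)"
    using scale by (intro mult_left_mono norm_higher_deriv_le radius) auto
  also have "\<dots> = fact n * A * (1 - \<rho>) powr - c / \<rho> ^ n * s powr - c"
    using scale radius by (simp add: power_mult_distrib powr_mult)
  also have "s powr - c = exp (c * t)"
    by (simp add: s_def powr_def)
  finally show ?thesis .
qed

lemma has_vector_derivative_scaled_deriv:
  assumes t_nonneg: "t \<ge> 0"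
  shows "(scaled_deriv n has_vector_derivative
           scaled_deriv (Suc n) t + - of_nat n * scaled_deriv n t) (at t)"
proof -
  define e where "e t = (of_real (exp (- t)) :: complex)" for t
  have "one_minus_exp t \<in> ball 0 1"
    using norm_one_minus_exp_less_1[OF t_nonneg] by simp
  then have "((deriv ^^ n) f has_field_derivative (deriv ^^ Suc n) f (one_minus_exp t))
      (at (one_minus_exp t))"
    using holomorphic_derivI[OF holomorphic_higher_deriv[OF holomorphic open_ball, of n] open_ball]
    by simp
  from field_vector_diff_chain_at[OF has_vector_derivative_one_minus_exp this]
  have deriv_f: "((\<lambda>t. (deriv ^^ n) f (one_minus_exp t)) has_vector_derivative
      e t * (deriv ^^ Suc n) f (one_minus_exp t)) (at t)"
    by (simp add: o_def e_def)
  have "((\<lambda>t. exp (- t) ^ n) has_real_derivative - real n * exp (- t) ^ n) (at t)"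
    unfolding exp_of_nat_mult[symmetric] by (auto intro!: derivative_eq_intros)
  from has_vector_derivative_of_real[OF this, where 'a = complex]
  have deriv_e: "((\<lambda>t. e t ^ n) has_vector_derivative - of_nat n * e t ^ n) (at t)"
    by (simp add: e_def)
  have "scaled_deriv n = (\<lambda>t. e t ^ n * (deriv ^^ n) f (one_minus_exp t))" for n
    by (simp add: scaled_deriv_def e_def fun_eq_iff)
  with has_vector_derivative_mult[OF deriv_e deriv_f] show ?thesis
    by (simp add: mult_ac add.commute)
qed

lemma exponential_order_scaled_deriv: "exponential_order c (scaled_deriv n)"
proof (rule exponential_orderI)
  show "continuous_on {0..} (scaled_deriv n)"
    using has_vector_derivative_scaled_deriv[THEN has_vector_derivative_continuous]
    by (auto intro!: continuous_at_imp_continuous_on)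
  show "norm (scaled_deriv n t) \<le> fact n * A * (1 - 1 / 2) powr - c / (1 / 2) ^ n * exp (c * t)"
    if "t \<ge> 0" for t
    by (rule norm_scaled_deriv_le[OF that]) auto
qed

lemma laplace_scaled_deriv_rec:
  assumes Re_z: "Re z > c"
  shows "(z + of_nat n) * laplace (scaled_deriv n) z
           = (deriv ^^ n) f 0 + laplace (scaled_deriv (Suc n)) z"
proof -
  have "laplace (\<lambda>t. scaled_deriv (Suc n) t + - of_nat n * scaled_deriv n t) z
      = z * laplace (scaled_deriv n) z - scaled_deriv n 0"
    by (intro laplace_derivative[OF _ _ has_vector_derivative_scaled_deriv Re_z]
        exponential_order_add exponential_order_cmult exponential_order_scaled_deriv)
  also have "laplace (\<lambda>t. scaled_deriv (Suc n) t + - of_nat n * scaled_deriv n t) z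
      = laplace (scaled_deriv (Suc n)) z - of_nat n * laplace (scaled_deriv n) z"
    using laplace_add[OF exponential_order_scaled_deriv
        exponential_order_cmult[OF exponential_order_scaled_deriv] Re_z]
    by (simp only: laplace_cmult) simp
  finally show ?thesis
    by (simp add: scaled_deriv_at_0 algebra_simps)
qed

lemma pochhammer_neq_0:
  assumes "Re z > c"
  shows "pochhammer z n \<noteq> 0"
  using assms c_nonneg by (auto simp: pochhammer_eq_0_iff)

lemma laplace_factorial_expansion:
  assumes Re_z: "Re z > c"
  shows "laplace (\<lambda>t. f (one_minus_exp t)) z
           = (\<Sum>n<N. (deriv ^^ n) f 0 / pochhammer z (Suc n))
             + laplace (scaled_deriv N) z / pochhammer z N"
proof (induction N)
  case 0
  show ?case
    by (simp add: scaled_deriv_0[abs_def])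
next
  case (Suc N)
  have "z + of_nat N \<noteq> 0"
    using pochhammer_neq_0[OF Re_z, of "Suc N"] by (simp add: pochhammer_Suc)
  then have "laplace (scaled_deriv N) z / pochhammer z N
      = (z + of_nat N) * laplace (scaled_deriv N) z / pochhammer z (Suc N)"
    by (simp add: pochhammer_Suc)
  also have "\<dots> = (deriv ^^ N) f 0 / pochhammer z (Suc N)
      + laplace (scaled_deriv (Suc N)) z / pochhammer z (Suc N)"
    by (simp only: laplace_scaled_deriv_rec[OF Re_z] add_divide_distrib)
  finally show ?case
    using Suc.IH by simp
qed

lemma norm_laplace_scaled_deriv_le:
  assumes Re_z: "Re z > c" and radius: "0 < \<rho>" "\<rho> < 1"
  shows "norm (laplace (scaled_deriv n) z)
           \<le> fact n * A * ((1 - \<rho>) powr - c / \<rho> ^ n) / (Re z - c)"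
  using exponential_order_scaled_deriv[of n] norm_scaled_deriv_le[OF _ radius, of _ n]
  by (intro norm_laplace_le Re_z) (auto simp: exponential_order_def)

theorem factorial_series_remainder_le:
  assumes c_pos: "c > 0" and Re_z: "Re z > c"
  shows "norm (laplace (\<lambda>t. f (one_minus_exp t)) z
               - (\<Sum>n\<le>N. (deriv ^^ n) f 0 / pochhammer z (Suc n)))
           \<le> R_fact 1 A c N z"
proof -
  define K where
    "K = (real (Suc N) + c) powr (real (Suc N) + c) / (c powr c * real (Suc N) ^ Suc N)"
  have "norm (laplace (\<lambda>t. f (one_minus_exp t)) z
        - (\<Sum>n\<le>N. (deriv ^^ n) f 0 / pochhammer z (Suc n)))
      = norm (laplace (scaled_deriv (Suc N)) z) / norm (pochhammer z (Suc N))"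
    by (simp only: laplace_factorial_expansion[OF Re_z, of "Suc N"] lessThan_Suc_atMost
        add_diff_cancel_left' norm_divide)
  also have "\<dots> \<le> fact (Suc N) * A * K / (Re z - c) / norm (pochhammer z (Suc N))"
    using norm_laplace_scaled_deriv_le[OF
        Re_z optimal_cauchy_radius(1,2)[OF c_pos zero_less_Suc], of "Suc N" N]
    unfolding optimal_cauchy_radius(3)[OF c_pos zero_less_Suc] K_def
    by (intro divide_right_mono norm_ge_zero)
  also have "fact (Suc N) * A * K
      = A / c powr c * ((real N + c + 1) powr (real N + c + 1) / (real N + 1) ^ N) * fact N"
    by (simp add: K_def add_ac)
  finally show ?thesis
    unfolding R_fact_1_conv_pochhammer[OF c_nonneg Re_z] by (simp add: mult_ac)
qed

theorem factorial_series:
  assumes Re_z: "Re z > max c 1"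
  shows "summable (\<lambda>n. norm ((deriv ^^ n) f 0 / pochhammer z (Suc n)))"
    and "(\<lambda>n. (deriv ^^ n) f 0 / pochhammer z (Suc n)) sums laplace (\<lambda>t. f (one_minus_exp t)) z"
proof -
  define \<beta> where "\<beta> n = (deriv ^^ n) f 0 / fact n" for n
  define b where "b = (max c 1 + Re z) / 2"
  have exponent: "b \<ge> c" "b > 1" "b < Re z"
    using Re_z by (auto simp: b_def)
  have terms: "(deriv ^^ n) f 0 / pochhammer w (Suc n) = \<beta> n * (fact n / pochhammer w (Suc n))"
    for w n
    by (simp add: \<beta>_def)
  have coeffs: "(\<lambda>n. norm (\<beta> n)) \<in> O(\<lambda>n. real n powr (b - 1))"
    unfolding \<beta>_def
    by (rule higher_deriv_bigo_powr[OF holomorphic exponent(2) growth_powr[OF exponent(1)]])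
  show "summable (\<lambda>n. norm ((deriv ^^ n) f 0 / pochhammer z (Suc n)))"
    unfolding terms using exponent by (intro summable_factorial_series[OF coeffs]) auto
  have "conv_radius \<beta> \<ge> 1"
    using conv_radius_fps_expansion[of f 0 "ereal 1"] holomorphic
    by (simp add: fps_conv_radius_def fps_expansion_def one_ereal_def \<beta>_def[abs_def])
  moreover have "summable (\<lambda>n. norm (\<beta> n * (fact n / pochhammer (of_real (Re z)) (Suc n))))"
    using exponent by (intro summable_factorial_series[OF coeffs]) auto
  ultimately have "(\<lambda>n. \<beta> n * (fact n / pochhammer z (Suc n))) sums
      laplace (\<lambda>t. \<Sum>n. \<beta> n * one_minus_exp t ^ n) z"
    using Re_z by (intro laplace_power_series_one_minus_exp) auto
  also have "laplace (\<lambda>t. \<Sum>n. \<beta> n * one_minus_exp t ^ n) z = laplace (\<lambda>t. f (one_minus_exp t)) z"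
  proof -
    have "(\<lambda>n. \<beta> n * one_minus_exp t ^ n) sums f (one_minus_exp t)" if "t \<ge> 0" for t
      using holomorphic_power_series[OF holomorphic, of "one_minus_exp t"]
        norm_one_minus_exp_less_1[OF that]
      by (simp add: \<beta>_def)
    then show ?thesis
      unfolding laplace_def by (intro integral_cong) (simp add: sums_iff)
  qed
  finally show "(\<lambda>n. (deriv ^^ n) f 0 / pochhammer z (Suc n)) sums
      laplace (\<lambda>t. f (one_minus_exp t)) z"
    unfolding terms .
qed

end

subsection \<open>Gevrey series, Stirling numbers and Borel sums\<close>

lemma gevrey1_conv_radius_pos:
  assumes "gevrey1 a"
  shows "conv_radius (\<lambda>n. a (Suc n) / fact n) > 0"
proof -
  obtain C K where gevrey_bound: "\<And>n. norm (a n) \<le> C * K ^ n * fact n"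
    using assms unfolding gevrey1_def by blast
  define D x where "D = \<bar>C\<bar> * \<bar>K\<bar>" and "x = 1 / (2 * (\<bar>K\<bar> + 1))"
  have radius: "x > 0" "\<bar>K\<bar> * x < 1"
    by (auto simp: x_def field_simps)
  have bound: "norm (a (Suc n) / fact n * of_real x ^ n) \<le> D * (real (Suc n) * (\<bar>K\<bar> * x) ^ n)" for n
  proof -
    have "C * K ^ Suc n * fact (Suc n) \<le> \<bar>C * K ^ Suc n * fact (Suc n)\<bar>"
      by (rule abs_ge_self)
    also have "\<dots> = D * \<bar>K\<bar> ^ n * (real (Suc n) * fact n)"
      by (simp add: D_def abs_mult power_abs)
    finally have "norm (a (Suc n)) \<le> D * \<bar>K\<bar> ^ n * (real (Suc n) * fact n)"
      using gevrey_bound[of "Suc n"] by linarith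
    then have "norm (a (Suc n)) / fact n * x ^ n
        \<le> D * \<bar>K\<bar> ^ n * (real (Suc n) * fact n) / fact n * x ^ n"
      using radius by (intro mult_right_mono divide_right_mono) auto
    also have "\<dots> = D * (real (Suc n) * (\<bar>K\<bar> * x) ^ n)"
      by (simp add: power_mult_distrib)
    finally show ?thesis
      using radius by (simp add: norm_mult norm_divide norm_power)
  qed
  have "summable (\<lambda>n. D * (real (Suc n) * (\<bar>K\<bar> * x) ^ n))"
    using geometric_deriv_sums[of "\<bar>K\<bar> * x"] radius by (intro summable_mult) (auto simp: sums_iff)
  then have "summable (\<lambda>n. a (Suc n) / fact n * of_real x ^ n)"
    by (rule summable_comparison_test'[OF _ bound])
  then have "ereal (norm (of_real x :: complex)) \<le> conv_radius (\<lambda>n. a (Suc n) / fact n)"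
    by (rule conv_radius_geI)
  then show ?thesis
    using radius by (auto simp: zero_ereal_def intro: less_le_trans[of _ "ereal x"])
qed

lemma higher_deriv_borel_transform_0:
  assumes "gevrey1 a" and "\<forall>\<^sub>F \<zeta> in nhds 0. F \<zeta> = borel_transform a \<zeta>"
  shows "(deriv ^^ n) F 0 = a (Suc n)"
proof -
  define G where "G = Abs_fps (\<lambda>n. a (Suc n) / fact n)"
  have "eval_fps G \<zeta> = borel_transform a \<zeta>" for \<zeta>
    by (simp add: eval_fps_def G_def borel_transform_def)
  then have "F has_fps_expansion G"
    using assms gevrey1_conv_radius_pos[OF assms(1)]
    by (simp add: has_fps_expansion_def fps_conv_radius_def G_def eq_commute)
  from fps_nth_fps_expansion[OF this, of n] show ?thesis
    by (simp add: G_def)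
qed

lemma stirling1_Suc:
  "stirling1 (Suc n) k = (if k = 0 then 0 else stirling1 n (k - 1)) - int n * stirling1 n k"
  by (cases k) (simp_all add: stirling1_def mult.commute[of _ "[:_, _:]"])

lemma stirling1_conv_stirling: "stirling1 n k = (- 1) ^ (n + k) * int (stirling n k)"
proof (induction n arbitrary: k)
  case 0
  then show ?case
    by (cases k) (simp_all add: stirling1_def)
next
  case (Suc n)
  have "n = 0 \<or> stirling n 0 = 0"
    by (cases n) simp_all
  with Suc.IH show ?case
    by (cases k) (simp_all add: stirling1_Suc algebra_simps)
qed

lemma b_lam_conv_stirling:
  "fact n * b_lam lam a n = (\<Sum>j\<le>n. of_nat (stirling n j) * (of_real lam ^ j * a (Suc j)))"
proof -
  have "fact n * b_lam lam a n
      = (\<Sum>k=1..n+1. (- 1) ^ (n + 1 - k) * of_int (stirling1 n (k - 1)) * a_lam lam a k)"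
    by (simp add: b_lam_def)
  also have "\<dots> = (\<Sum>j\<le>n. (- 1) ^ (n - j) * of_int (stirling1 n j) * (of_real lam ^ j * a (Suc j)))"
    by (rule sum.reindex_bij_witness[of _ Suc "\<lambda>k. k - 1"]) (auto simp: a_lam_def)
  also have "\<dots> = (\<Sum>j\<le>n. of_nat (stirling n j) * (of_real lam ^ j * a (Suc j)))"
  proof (intro sum.cong refl)
    fix j assume "j \<in> {..n}"
    then have "(- 1) ^ (n - j) * (- 1) ^ (n + j) = (1 :: complex)"
      by (simp flip: power_add)
    then show "(- 1) ^ (n - j) * of_int (stirling1 n j) * (of_real lam ^ j * a (Suc j))
        = of_nat (stirling n j) * (of_real lam ^ j * a (Suc j))"
      by (simp add: stirling1_conv_stirling flip: mult.assoc)
  qed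
  finally show ?thesis .
qed

lemma sum_stirling_Suc:
  fixes x :: "nat \<Rightarrow> 'a::comm_semiring_1"
  shows "(\<Sum>j\<le>Suc n. of_nat (stirling (Suc n) j) * x j)
           = of_nat n * (\<Sum>j\<le>n. of_nat (stirling n j) * x j)
             + (\<Sum>j\<le>n. of_nat (stirling n j) * x (Suc j))"
proof -
  have "(\<Sum>j\<le>Suc n. of_nat (stirling (Suc n) j) * x j)
      = of_nat n * (\<Sum>j\<le>n. of_nat (stirling n (Suc j)) * x (Suc j))
        + (\<Sum>j\<le>n. of_nat (stirling n j) * x (Suc j))"
    unfolding sum.atMost_Suc_shift by (simp add: sum_distrib_left sum.distrib algebra_simps)
  moreover have "of_nat n * (\<Sum>j\<le>Suc n. of_nat (stirling n j) * x j)
      = of_nat n * (\<Sum>j\<le>n. of_nat (stirling n (Suc j)) * x (Suc j))"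
    unfolding sum.atMost_Suc_shift by (cases n) simp_all
  ultimately show ?thesis
    by simp
qed

lemma DERIV_divide_one_minus_power:
  fixes P :: "'a::real_normed_field \<Rightarrow> 'a"
  assumes deriv: "(P has_field_derivative D) (at u)" and nonzero: "1 - u \<noteq> 0"
  shows "((\<lambda>u. P u / (1 - u) ^ n) has_field_derivative
           (D * (1 - u) + of_nat n * P u) / (1 - u) ^ Suc n) (at u)"
proof -
  have "((\<lambda>u. (1 - u) ^ n) has_field_derivative of_nat n * (- 1 * (1 - u) ^ (n - Suc 0))) (at u)"
    by (intro DERIV_power) (auto intro!: derivative_eq_intros)
  also have "of_nat n * (- 1 * (1 - u) ^ (n - Suc 0)) = - (of_nat n * (1 - u) ^ n / (1 - u))"
    using nonzero by (cases n) simp_all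
  finally have "((\<lambda>u. P u / (1 - u) ^ n) has_field_derivative
      (D * (1 - u) ^ n - P u * - (of_nat n * (1 - u) ^ n / (1 - u)))
        / ((1 - u) ^ n * (1 - u) ^ n)) (at u)"
    using nonzero by (intro DERIV_divide[OF deriv]) auto
  also have "(D * (1 - u) ^ n - P u * - (of_nat n * (1 - u) ^ n / (1 - u)))
        / ((1 - u) ^ n * (1 - u) ^ n)
      = (D * (1 - u) + of_nat n * P u) / (1 - u) ^ Suc n"
  proof -
    have "(D * w - x * - (k * w / v)) / (w * w) = (D * v + k * x) / (v * w)"
      if "w \<noteq> 0" "v \<noteq> 0" for w v x k :: 'a
      using that by (simp add: divide_simps) (simp add: algebra_simps)
    from this[of "(1 - u) ^ n" "1 - u" "P u" "of_nat n"] nonzero show ?thesis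
      by simp
  qed
  finally show ?thesis .
qed

lemma one_minus_notin_nonpos_Reals: "norm u < 1 \<Longrightarrow> 1 - u \<notin> \<real>\<^sub>\<le>\<^sub>0" for u :: complex
  using complex_Re_le_cmod[of u] by (auto simp: complex_nonpos_Reals_iff)

lemma DERIV_compose_neg_Ln:
  fixes G :: "complex \<Rightarrow> complex"
  assumes "(G has_field_derivative D) (at (- Ln (1 - u)))" and "norm u < 1"
  shows "((\<lambda>u. G (- Ln (1 - u))) has_field_derivative D / (1 - u)) (at u)"
proof -
  have "((\<lambda>u. - Ln (1 - u)) has_field_derivative 1 / (1 - u)) (at u)"
    using one_minus_notin_nonpos_Reals[OF assms(2)]
    by (auto intro!: derivative_eq_intros simp: inverse_eq_divide)
  from DERIV_chain2[OF assms(1) this] show ?thesis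
    by simp
qed

text \<open>With \<open>u = 1 - exp (- x)\<close> and \<open>D = d/dx\<close> one has
  \<open>(1 - u)\<^sup>n (d/du)\<^sup>n = D (D + 1) \<dots> (D + n - 1)\<close>.\<close>

lemma higher_deriv_compose_neg_Ln:
  assumes holomorphic: "G holomorphic_on T" and open_T: "open T"
    and S: "open S" "S \<subseteq> ball 0 1"
    and maps_S: "\<And>u. u \<in> S \<Longrightarrow> - Ln (1 - u) \<in> T" and in_S: "u \<in> S"
  shows "(deriv ^^ n) (\<lambda>u. G (- Ln (1 - u))) u
           = (\<Sum>j\<le>n. of_nat (stirling n j) * (deriv ^^ j) G (- Ln (1 - u))) / (1 - u) ^ n"
  using in_S
proof (induction n arbitrary: u)
  case 0
  then show ?case
    by simp
next
  case (Suc n)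
  define P where "P u = (\<Sum>j\<le>n. of_nat (stirling n j) * (deriv ^^ j) G (- Ln (1 - u)))" for u
  define P' where "P' = (\<Sum>j\<le>n. of_nat (stirling n j) * (deriv ^^ Suc j) G (- Ln (1 - u)))"
  have norm_u: "norm u < 1"
    using Suc.prems S(2) by auto
  then have nonzero: "1 - u \<noteq> 0"
    by auto
  have "((deriv ^^ j) G has_field_derivative (deriv ^^ Suc j) G (- Ln (1 - u)))
      (at (- Ln (1 - u)))" for j
    using holomorphic_derivI[OF
        holomorphic_higher_deriv[OF holomorphic open_T] open_T maps_S[OF Suc.prems]]
    by simp
  from DERIV_compose_neg_Ln[OF this norm_u]
  have "((\<lambda>u. (deriv ^^ j) G (- Ln (1 - u))) has_field_derivative
      (deriv ^^ Suc j) G (- Ln (1 - u)) / (1 - u)) (at u)" for j .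
  then have "(P has_field_derivative P' / (1 - u)) (at u)"
    unfolding P_def[abs_def] P'_def sum_divide_distrib
    by (intro DERIV_sum) (auto intro!: derivative_eq_intros simp del: funpow.simps)
  from DERIV_divide_one_minus_power[OF this, of n] have quotient:
    "((\<lambda>u. P u / (1 - u) ^ n) has_field_derivative (P' + of_nat n * P u) / (1 - u) ^ Suc n) (at u)"
    using nonzero by simp
  have "\<forall>\<^sub>F v in nhds u. (deriv ^^ n) (\<lambda>u. G (- Ln (1 - u))) v = P v / (1 - v) ^ n"
    using eventually_nhds_in_open[OF S(1) Suc.prems] by eventually_elim (simp add: Suc.IH P_def)
  then have "(deriv ^^ Suc n) (\<lambda>u. G (- Ln (1 - u))) u = deriv (\<lambda>u. P u / (1 - u) ^ n) u"
    by (simp add: deriv_cong_ev)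
  also have "\<dots> = (of_nat n * P u + P') / (1 - u) ^ Suc n"
    using DERIV_imp_deriv[OF quotient] by (simp only: add.commute)
  also have "of_nat n * P u + P'
      = (\<Sum>j\<le>Suc n. of_nat (stirling (Suc n) j) * (deriv ^^ j) G (- Ln (1 - u)))"
    unfolding sum_stirling_Suc P_def P'_def ..
  finally show ?case .
qed

definition disc_pullback :: "real \<Rightarrow> (complex \<Rightarrow> complex) \<Rightarrow> complex \<Rightarrow> complex" where
  "disc_pullback lam F u = F (of_real lam * - Ln (1 - u))"

lemma disc_pullback_one_minus_exp:
  "disc_pullback lam F (one_minus_exp t) = F (of_real (lam * t))"
proof -
  have "Ln (of_real (exp (- t))) = of_real (- t)"
    by (subst Ln_of_real) auto
  then show ?thesis
    by (simp add: disc_pullback_def one_minus_exp_def)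
qed

lemma log_growth_disc_pullback:
  assumes holomorphic: "F holomorphic_on Delta_lam lam" and nonneg: "lam \<ge> 0" "B \<ge> 0"
    and bound: "\<And>\<zeta>. \<zeta> \<in> Delta_lam lam \<Longrightarrow> norm (F \<zeta>) \<le> A * exp (B * norm \<zeta>)"
  shows "log_growth (disc_pullback lam F) A (lam * B)"
proof
  have mem: "of_real lam * - Ln (1 - u) \<in> Delta_lam lam" if "u \<in> ball 0 1" for u
    using that unfolding Delta_lam_def Delta_def
    by (intro imageI image_eqI[of _ _ "1 - u"]) (auto simp: dist_norm)
  show "disc_pullback lam F holomorphic_on ball 0 1"
    unfolding disc_pullback_def
    by (rule holomorphic_on_compose_gen[OF _ holomorphic, unfolded o_def])
      (use mem one_minus_notin_nonpos_Reals in \<open>auto intro!: holomorphic_intros\<close>)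
  show "norm (disc_pullback lam F u) \<le> A * exp (lam * B * norm (Ln (1 - u)))"
    if "u \<in> ball 0 1" for u
    using bound[OF mem[OF that]] nonneg by (simp add: disc_pullback_def norm_mult mult_ac)
  show "lam * B \<ge> 0"
    using nonneg by simp
qed

lemma higher_deriv_disc_pullback_0:
  assumes gevrey: "gevrey1 a" and lam_pos: "lam > 0" and r_pos: "r > 0"
    and holomorphic: "F holomorphic_on ball 0 r"
    and eq: "\<And>\<zeta>. \<zeta> \<in> ball 0 r \<Longrightarrow> F \<zeta> = borel_transform a \<zeta>"
  shows "(deriv ^^ n) (disc_pullback lam F) 0 = fact n * b_lam lam a n"
proof -
  define T where "T = ball (0 :: complex) (r / lam)"
  define S where "S = ball 0 1 \<inter> (\<lambda>u. - Ln (1 - u)) -` T"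
  define G where "G x = F (of_real lam * x)" for x
  have T_maps: "of_real lam * x \<in> ball 0 r" if "x \<in> T" for x
    using that lam_pos by (simp add: T_def norm_mult field_simps)
  have "G holomorphic_on T"
    unfolding G_def by (rule holomorphic_on_compose_gen[OF _ holomorphic, unfolded o_def])
      (use T_maps in \<open>auto intro!: holomorphic_intros\<close>)
  moreover have "open S"
    unfolding S_def T_def using one_minus_notin_nonpos_Reals
    by (intro continuous_open_preimage) (auto intro!: continuous_intros)
  moreover have "0 \<in> S"
    using r_pos lam_pos by (simp add: S_def T_def)
  ultimately have "(deriv ^^ n) (\<lambda>u. G (- Ln (1 - u))) 0
      = (\<Sum>j\<le>n. of_nat (stirling n j) * (deriv ^^ j) G 0)"
    using higher_deriv_compose_neg_Ln[of G T S 0 n] by (auto simp: S_def T_def)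
  moreover have "\<forall>\<^sub>F \<zeta> in nhds 0. F \<zeta> = borel_transform a \<zeta>"
    using r_pos eq by (intro eventually_mono[OF eventually_nhds_in_open[of "ball 0 r"]]) auto
  then have "(deriv ^^ j) G 0 = of_real lam ^ j * a (Suc j)" for j
    using higher_deriv_compose_linear[OF holomorphic, of T 0 "of_real lam" j] T_maps r_pos lam_pos
      higher_deriv_borel_transform_0[OF gevrey]
    by (simp add: G_def[abs_def] T_def)
  ultimately show ?thesis
    by (simp add: b_lam_conv_stirling G_def disc_pullback_def[abs_def])
qed

lemma fact_term_conv_pochhammer:
  assumes "lam * Re z > 0"
  shows "fact_term lam a z n = fact n * b_lam lam a n / pochhammer (of_real lam * z) (Suc n)"
proof -
  let ?w = "of_real lam * z"
  have "fact_term lam a z n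
      = Gamma ?w * Gamma (of_nat n + 1) / Gamma (?w + of_nat n + 1) * b_lam lam a n"
    by (simp add: fact_term_def)
  also have "\<dots> = fact n / pochhammer ?w (Suc n) * b_lam lam a n"
    using assms by (subst Gamma_quotient_conv_pochhammer) auto
  finally show ?thesis
    by simp
qed

lemma R_fact_rescale:
  assumes "lam > 0"
  shows "R_fact lam A B N z = lam * R_fact 1 A (lam * B) N (of_real lam * z)"
proof -
  have "lam * \<bar>lam * x - lam * B\<bar> = lam * (lam * \<bar>x - B\<bar>)" for x
    using assms by (simp add: abs_mult flip: right_diff_distrib)
  then show ?thesis
    using assms
    by (simp add: R_fact_def norm_mult norm_divide abs_mult
        flip: right_diff_distrib of_real_diff)
qed

context
  fixes a :: "nat \<Rightarrow> complex" and F :: "complex \<Rightarrow> complex" and lam A B :: real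
  assumes lam_pos: "lam > 0"
    and log_growth: "log_growth (disc_pullback lam F) A (lam * B)"
    and coeff: "\<And>n. (deriv ^^ n) (disc_pullback lam F) 0 = fact n * b_lam lam a n"
begin

lemma borel_sum_eq_laplace:
  assumes "Re z > B"
  shows "borel_sum a0 F z = a0
           + of_real lam * laplace (\<lambda>t. disc_pullback lam F (one_minus_exp t)) (of_real lam * z)"
proof -
  interpret log_growth "disc_pullback lam F" A "lam * B"
    by (rule log_growth)
  have "borel_sum a0 F z = a0 + laplace (\<lambda>t. disc_pullback lam F (one_minus_exp (t / lam))) z"
    using lam_pos by (simp add: borel_sum_def laplace_def disc_pullback_one_minus_exp)
  then show ?thesis
    using laplace_rescale[OF exponential_order_scaled_deriv[of 0] lam_pos] assms lam_pos
    by (simp add: scaled_deriv_0[abs_def])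
qed

lemma fact_term_eq_higher_deriv:
  assumes "Re z > B"
  shows "fact_term lam a z n
           = (deriv ^^ n) (disc_pullback lam F) 0 / pochhammer (of_real lam * z) (Suc n)"
proof -
  interpret log_growth "disc_pullback lam F" A "lam * B"
    by (rule log_growth)
  have "lam * Re z > 0"
    using assms lam_pos c_nonneg by (simp add: zero_le_mult_iff)
  then show ?thesis
    by (simp only: fact_term_conv_pochhammer coeff)
qed

lemma borel_sum_factorial_series:
  assumes "Re z > max B (1 / lam)"
  shows "summable (\<lambda>n. norm (fact_term lam a z n))"
    and "a0 + of_real lam * (\<Sum>n. fact_term lam a z n) = borel_sum a0 F z"
proof -
  have "Re (of_real lam * z) > max (lam * B) 1"
    using assms lam_pos by (simp add: field_simps)
  note series = log_growth.factorial_series[OF log_growth this]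
  have "Re z > B"
    using assms by simp
  then show "summable (\<lambda>n. norm (fact_term lam a z n))"
    and "a0 + of_real lam * (\<Sum>n. fact_term lam a z n) = borel_sum a0 F z"
    using series by (simp_all add: fact_term_eq_higher_deriv borel_sum_eq_laplace sums_iff)
qed

lemma borel_sum_remainder_le_R_fact:
  assumes "B > 0" and "Re z > B"
  shows "norm (borel_sum a0 F z - (a0 + of_real lam * (\<Sum>n\<le>N. fact_term lam a z n)))
           \<le> R_fact lam A B N z"
proof -
  let ?f = "disc_pullback lam F" and ?w = "of_real lam * z"
  have "norm (borel_sum a0 F z - (a0 + of_real lam * (\<Sum>n\<le>N. fact_term lam a z n)))
      = lam * norm (laplace (\<lambda>t. ?f (one_minus_exp t)) ?w
          - (\<Sum>n\<le>N. (deriv ^^ n) ?f 0 / pochhammer ?w (Suc n)))"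
    using assms lam_pos
    by (simp add: fact_term_eq_higher_deriv borel_sum_eq_laplace norm_mult flip: right_diff_distrib)
  also have "\<dots> \<le> lam * R_fact 1 A (lam * B) N ?w"
    using assms lam_pos
    by (intro mult_left_mono log_growth.factorial_series_remainder_le[OF log_growth]) auto
  also have "\<dots> = R_fact lam A B N z"
    by (rule R_fact_rescale[OF lam_pos, symmetric])
  finally show ?thesis .
qed

end

theorem theorem3p2:
  fixes a :: "nat \<Rightarrow> complex" and F :: "complex \<Rightarrow> complex"
    and lam A B :: real
  assumes gev: "gevrey1 a"
    and lam: "lam > 0"
    and hol: "F holomorphic_on Delta_lam lam"
    and ext: "\<exists>r>0. ball 0 r \<subseteq> Delta_lam lam \<and>
                (\<forall>\<zeta>\<in>ball 0 r. F \<zeta> = borel_transform a \<zeta>)"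
    and A: "A > 0" and B: "B > 0"
    and bound: "\<forall>\<zeta>\<in>Delta_lam lam. norm (F \<zeta>) \<le> A * exp (B * norm \<zeta>)"
  shows "(\<forall>z. Re z > max B (1 / lam) \<longrightarrow>
            summable (\<lambda>n. norm (fact_term lam a z n)) \<and>
            a 0 + of_real lam * (\<Sum>n. fact_term lam a z n) = borel_sum (a 0) F z)
       \<and> (\<forall>N::nat. \<forall>z. Re z > B \<longrightarrow>
            norm (borel_sum (a 0) F z
                  - (a 0 + of_real lam * (\<Sum>n\<le>N. fact_term lam a z n)))
              \<le> R_fact lam A B N z)"
proof -
  have growth: "log_growth (disc_pullback lam F) A (lam * B)"
    by (rule log_growth_disc_pullback[OF hol less_imp_le[OF lam] less_imp_le[OF B] bspec[OF bound]])
  obtain r where r: "r > 0" "ball 0 r \<subseteq> Delta_lam lam"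
      "\<And>\<zeta>. \<zeta> \<in> ball 0 r \<Longrightarrow> F \<zeta> = borel_transform a \<zeta>"
    using ext by blast
  have coeff: "(deriv ^^ n) (disc_pullback lam F) 0 = fact n * b_lam lam a n" for n
    by (rule higher_deriv_disc_pullback_0[OF gev lam r(1) holomorphic_on_subset[OF hol r(2)] r(3)])
  show ?thesis
    by (intro conjI allI impI borel_sum_factorial_series[OF lam growth coeff]
        borel_sum_remainder_le_R_fact[OF lam growth coeff B])
qed

end
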